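(* Let $\Bbbk$ be an algebraically closed field of characteristic $0$, let $\mathfrak q$ be the Lie algebra of a connected affine algebraic group over $\Bbbk$, let $\mathfrak f\subset\mathfrak q$ be a Lie subalgebra, and suppose that $\mathfrak q=\mathfrak f\oplus\mathfrak m$ is a vector space decomposition with $[\mathfrak f,\mathfrak m]\subset\mathfrak m$. Let $\mathcal Z_{(\mathfrak q,\mathfrak f)}$ be the subalgebra of $\mathcal S(\mathfrak q)$ generated by the bi-homogeneous components (with respect to $\mathfrak q=\mathfrak f\oplus\mathfrak m$) of all $H\in\mathcal S(\mathfrak q)^{\mathfrak q}$. If $\mathfrak f$ is an abelian Lie algebra, then $\mathcal Z_{(\mathfrak q,\mathfrak f)}$ is Poisson commutative.
   Context: The symmetric algebra $\mathcal S(\mathfrak q)=\Bbbk[\mathfrak q^*]$ carries the Lie--Poisson bracket $\{\cdot,\cdot\}$, the Poisson bracket determined by $\{x,y\}=[x,y]$ for $x,y\in\mathfrak q$. A subalgebra $A\subset\mathcal S(\mathfrak q)$ is Poisson commutative if $\{A,A\}=0$. $\mathcal S(\mathfrak q)^{\mathfrak q}=\{H\in\mathcal S(\mathfrak q)\mid \{H,x\}=0\ \forall x\in\mathfrak q\}$. The decomposition $\mathfrak q=\mathfrak f\oplus\mathfrak m$ gives $\mathcal S(\mathfrak q)=\bigoplus_{i,j\ge 0}\mathcal S^i(\mathfrak f)\otimes\mathcal S^j(\mathfrak m)$; the bi-homogeneous components of $H$ are the elements $H_{(i,j)}\in\mathcal S^i(\mathfrak f)\otimes\mathcal S^j(\mathfrak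 m)$ with $H=\sum_{i,j}H_{(i,j)}$. *)

theory Defs
  imports
    "HOL-Algebra.Group"
    "HOL-Analysis.Abstract_Topology"
    "HOL-Computational_Algebra.Polynomial"
begin

section \<open>Algebras of functions\<close>

text \<open>
  The unital subalgebra, generated by \<open>X\<close>, of the algebra of all functions \<open>V \<rightarrow> 'k\<close> with
  pointwise operations. A function on \<open>V\<close> is represented by its extensional representative
  (\<open>undefined\<close> outside \<open>V\<close>), so that equality of functions on \<open>V\<close> is plain equality.
\<close>

inductive_set fun_alg :: "'p set \<Rightarrow> ('p \<Rightarrow> 'k::comm_ring_1) set \<Rightarrow> ('p \<Rightarrow> 'k) set"
  for V :: "'p set" and X :: "('p \<Rightarrow> 'k) set" where
  const: "(\<lambda>v\<in>V. c) \<in> fun_alg V X"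
| gen: "F \<in> X \<Longrightarrow> restrict F V \<in> fun_alg V X"
| add: "F \<in> fun_alg V X \<Longrightarrow> G \<in> fun_alg V X \<Longrightarrow> (\<lambda>v\<in>V. F v + G v) \<in> fun_alg V X"
| mult: "F \<in> fun_alg V X \<Longrightarrow> G \<in> fun_alg V X \<Longrightarrow> (\<lambda>v\<in>V. F v * G v) \<in> fun_alg V X"

lemma fun_alg_extensional: "F \<in> fun_alg V X \<Longrightarrow> F \<in> extensional V"
  by (erule fun_alg.cases) auto

text \<open>
  A Poisson bracket on an algebra \<open>A\<close> of functions on \<open>V\<close>. Linearity and the Leibniz rule in the
  second argument follow from skew-symmetry. Outside \<open>A\<close> the bracket is \<open>undefined\<close>.
\<close>

definition poisson_bracket ::
  "'p set \<Rightarrow> ('p \<Rightarrow> 'k::field_char_0) set \<Rightarrow> (('p \<Rightarrow> 'k) \<Rightarrow> ('p \<Rightarrow> 'k) \<Rightarrow> ('p \<Rightarrow> 'k)) \<Rightarrow> bool"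
where
  "poisson_bracket V A P \<longleftrightarrow>
     (\<forall>F\<in>A. \<forall>G\<in>A. P F G \<in> A) \<and>
     (\<forall>F G. F \<notin> A \<or> G \<notin> A \<longrightarrow> P F G = undefined) \<and>
     (\<forall>F\<in>A. \<forall>G\<in>A. P G F = (\<lambda>v\<in>V. - P F G v)) \<and>
     (\<forall>F\<in>A. \<forall>G\<in>A. \<forall>H\<in>A. P (\<lambda>v\<in>V. F v + G v) H = (\<lambda>v\<in>V. P F H v + P G H v)) \<and>
     (\<forall>F\<in>A. \<forall>G\<in>A. \<forall>c. P (\<lambda>v\<in>V. c * F v) G = (\<lambda>v\<in>V. c * P F G v)) \<and>
     (\<forall>F\<in>A. \<forall>G\<in>A. \<forall>H\<in>A. P (\<lambda>v\<in>V. F v * G v) H = (\<lambda>v\<in>V. F v * P G H v + G v * P F H v)) \<and>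
     (\<forall>F\<in>A. \<forall>G\<in>A. \<forall>H\<in>A. \<forall>v\<in>V. P F (P G H) v + P G (P H F) v + P H (P F G) v = 0)"

lemma poisson_bracketD:
  assumes "poisson_bracket V A P" and "F \<in> A" and "G \<in> A"
  shows "P G F = (\<lambda>v\<in>V. - P F G v)"
    and "H \<in> A \<Longrightarrow> P (\<lambda>v\<in>V. F v + G v) H = (\<lambda>v\<in>V. P F H v + P G H v)"
    and "P (\<lambda>v\<in>V. c * F v) G = (\<lambda>v\<in>V. c * P F G v)"
    and "H \<in> A \<Longrightarrow> P (\<lambda>v\<in>V. F v * G v) H = (\<lambda>v\<in>V. F v * P G H v + G v * P F H v)"
  using assms unfolding poisson_bracket_def by blast+


section \<open>Affine algebraic groups and their Lie algebras\<close>

text \<open>Affine \<open>n\<close>-space over \<open>'k\<close>, its polynomial functions and its Zariski topology.\<close>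

definition affine_space :: "nat \<Rightarrow> (nat \<Rightarrow> 'k) set" where
  "affine_space n = {..<n} \<rightarrow>\<^sub>E UNIV"

definition regular_functions :: "nat \<Rightarrow> (nat \<Rightarrow> 'k::comm_ring_1) set \<Rightarrow> ((nat \<Rightarrow> 'k) \<Rightarrow> 'k) set" where
  "regular_functions n Y = fun_alg Y {(\<lambda>p. p i) | i. i < n}"

definition zero_locus :: "nat \<Rightarrow> ((nat \<Rightarrow> 'k::comm_ring_1) \<Rightarrow> 'k) set \<Rightarrow> (nat \<Rightarrow> 'k) set" where
  "zero_locus n I = {p \<in> affine_space n. \<forall>F\<in>I. F p = 0}"

definition zariski :: "nat \<Rightarrow> (nat \<Rightarrow> 'k::idom) topology" where
  "zariski n = topology (\<lambda>U. \<exists>I \<subseteq> regular_functions n (affine_space n).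
     U = affine_space n - zero_locus n I)"

lemma openin_zariski:
  "openin (zariski n) U \<longleftrightarrow>
     (\<exists>I \<subseteq> regular_functions n (affine_space n). U = affine_space n - zero_locus n I)"
proof -
  let ?A = "affine_space n :: (nat \<Rightarrow> 'a) set" and ?R = "regular_functions n (affine_space n)"
  let ?L = "\<lambda>U::(nat \<Rightarrow> 'a) set. \<exists>I \<subseteq> ?R. U = ?A - zero_locus n I"
  have "istopology ?L"
    unfolding istopology_def
  proof (intro conjI allI impI)
    fix S T assume "?L S" "?L T"
    then obtain I J where I: "I \<subseteq> ?R" "S = ?A - zero_locus n I"
      and J: "J \<subseteq> ?R" "T = ?A - zero_locus n J" by blast
    let ?K = "{(\<lambda>p\<in>?A. F p * G p) | F G. F \<in> I \<and> G \<in> J}"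
    have "?K \<subseteq> ?R"
      using I(1) J(1) unfolding regular_functions_def by (auto intro!: fun_alg.mult)
    moreover have "S \<inter> T = ?A - zero_locus n ?K"
      unfolding I(2) J(2) zero_locus_def by fastforce
    ultimately show "?L (S \<inter> T)" by blast
  next
    fix \<K> assume "\<forall>K\<in>\<K>. ?L K"
    then obtain I where I: "\<And>K. K \<in> \<K> \<Longrightarrow> I K \<subseteq> ?R \<and> K = ?A - zero_locus n (I K)"
      by metis
    have "\<Union>\<K> = ?A - zero_locus n (\<Union>(I ` \<K>))"
    proof (intro Set.set_eqI iffI)
      fix p assume "p \<in> \<Union>\<K>"
      then obtain K where "K \<in> \<K>" "p \<in> K" by blast
      with I[of K] show "p \<in> ?A - zero_locus n (\<Union>(I ` \<K>))"
        unfolding zero_locus_def by blast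
    next
      fix p assume p: "p \<in> ?A - zero_locus n (\<Union>(I ` \<K>))"
      then obtain K F where "K \<in> \<K>" "F \<in> I K" "F p \<noteq> 0" by (auto simp: zero_locus_def)
      with p have "p \<in> ?A - zero_locus n (I K)" by (auto simp: zero_locus_def)
      with I[of K] \<open>K \<in> \<K>\<close> show "p \<in> \<Union>\<K>" by blast
    qed
    moreover have "\<Union>(I ` \<K>) \<subseteq> ?R" using I by blast
    ultimately show "?L (\<Union>\<K>)" by blast
  qed
  then show ?thesis unfolding zariski_def by simp
qed

text \<open>
  An affine algebraic group is a Zariski closed subset \<open>G\<close> of affine space with a group structure
  whose multiplication and inversion are morphisms of varieties, i.e. whose coordinates are
  restrictions of polynomials to \<open>G \<times> G\<close> and to \<open>G\<close>.
\<close>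

definition affine_algebraic_group :: "nat \<Rightarrow> (nat \<Rightarrow> 'k::idom) monoid \<Rightarrow> bool" where
  "affine_algebraic_group n G \<longleftrightarrow>
     group G \<and> closedin (zariski n) (carrier G) \<and>
     (\<forall>i<n. (\<lambda>(p, q)\<in>carrier G \<times> carrier G. (p \<otimes>\<^bsub>G\<^esub> q) i)
        \<in> fun_alg (carrier G \<times> carrier G)
            ({(\<lambda>(p, q). p j) | j. j < n} \<union> {(\<lambda>(p, q). q j) | j. j < n})) \<and>
     (\<forall>i<n. (\<lambda>p\<in>carrier G. (inv\<^bsub>G\<^esub> p) i) \<in> regular_functions n (carrier G))"

definition connected_algebraic_group :: "nat \<Rightarrow> (nat \<Rightarrow> 'k::idom) monoid \<Rightarrow> bool" where
  "connected_algebraic_group n G \<longleftrightarrow>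
     affine_algebraic_group n G \<and> connectedin (zariski n) (carrier G)"

definition left_translate ::
  "(nat \<Rightarrow> 'k) monoid \<Rightarrow> (nat \<Rightarrow> 'k) \<Rightarrow> ((nat \<Rightarrow> 'k) \<Rightarrow> 'k) \<Rightarrow> ((nat \<Rightarrow> 'k) \<Rightarrow> 'k)" where
  "left_translate G g F = (\<lambda>p\<in>carrier G. F (inv\<^bsub>G\<^esub> g \<otimes>\<^bsub>G\<^esub> p))"

text \<open>
  The Lie algebra of \<open>G\<close> consists of the left-invariant derivations of the coordinate ring of \<open>G\<close>,
  with the commutator as bracket.
\<close>

definition invariant_derivations ::
  "nat \<Rightarrow> (nat \<Rightarrow> 'k::field) monoid \<Rightarrow> (((nat \<Rightarrow> 'k) \<Rightarrow> 'k) \<Rightarrow> ((nat \<Rightarrow> 'k) \<Rightarrow> 'k)) set" where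
  "invariant_derivations n G = (let R = regular_functions n (carrier G) in
     {D \<in> R \<rightarrow>\<^sub>E R.
        (\<forall>E\<in>R. \<forall>F\<in>R. D (\<lambda>p\<in>carrier G. E p + F p) = (\<lambda>p\<in>carrier G. D E p + D F p)) \<and>
        (\<forall>F\<in>R. \<forall>c. D (\<lambda>p\<in>carrier G. c * F p) = (\<lambda>p\<in>carrier G. c * D F p)) \<and>
        (\<forall>E\<in>R. \<forall>F\<in>R. D (\<lambda>p\<in>carrier G. E p * F p) = (\<lambda>p\<in>carrier G. E p * D F p + F p * D E p)) \<and>
        (\<forall>F\<in>R. \<forall>g\<in>carrier G. D (left_translate G g F) = left_translate G g (D F))})"


section \<open>Lie algebras and their symmetric algebras\<close>

locale lie_algebra = vector_space scale
  for scale :: "'k::field_char_0 \<Rightarrow> 'q::ab_group_add \<Rightarrow> 'q" (infixr \<open>*s\<close> 75) +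
  fixes br :: "'q \<Rightarrow> 'q \<Rightarrow> 'q"
  assumes br_add_left: "br (x + y) z = br x z + br y z"
    and br_add_right: "br x (y + z) = br x y + br x z"
    and br_scale_left: "br (c *s x) y = c *s br x y"
    and br_scale_right: "br x (c *s y) = c *s br x y"
    and br_self: "br x x = 0"
    and jacobi: "br x (br y z) + br y (br z x) + br z (br x y) = 0"
begin

definition lie_subalgebra :: "'q set \<Rightarrow> bool" where
  "lie_subalgebra f \<longleftrightarrow> subspace f \<and> (\<forall>x\<in>f. \<forall>y\<in>f. br x y \<in> f)"

text \<open>The Lie algebra is (isomorphic to) the Lie algebra of the algebraic group \<open>G\<close>.\<close>

definition is_Lie_algebra_of :: "nat \<Rightarrow> (nat \<Rightarrow> 'k) monoid \<Rightarrow> bool" where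
  "is_Lie_algebra_of n G \<longleftrightarrow> (let R = regular_functions n (carrier G) in
     \<exists>\<theta>. bij_betw \<theta> UNIV (invariant_derivations n G) \<and>
       (\<forall>x y. \<theta> (x + y) = (\<lambda>F\<in>R. \<lambda>p\<in>carrier G. \<theta> x F p + \<theta> y F p)) \<and>
       (\<forall>c x. \<theta> (c *s x) = (\<lambda>F\<in>R. \<lambda>p\<in>carrier G. c * \<theta> x F p)) \<and>
       (\<forall>x y. \<theta> (br x y) = (\<lambda>F\<in>R. \<lambda>p\<in>carrier G. \<theta> x (\<theta> y F) p - \<theta> y (\<theta> x F) p)))"

text \<open>
  The symmetric algebra is realised as the algebra of polynomial functions on the dual space,
  an element \<open>x\<close> of the Lie algebra being identified with evaluation at \<open>x\<close>.
\<close>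

definition dual :: "('q \<Rightarrow> 'k) set" where
  "dual = {\<xi>. Vector_Spaces.linear scale (*) \<xi>}"

definition ev :: "'q \<Rightarrow> ('q \<Rightarrow> 'k) \<Rightarrow> 'k" where
  "ev x = (\<lambda>\<xi>\<in>dual. \<xi> x)"

definition Sym :: "(('q \<Rightarrow> 'k) \<Rightarrow> 'k) set" where
  "Sym = fun_alg dual (range ev)"

definition lie_poisson :: "(('q \<Rightarrow> 'k) \<Rightarrow> 'k) \<Rightarrow> (('q \<Rightarrow> 'k) \<Rightarrow> 'k) \<Rightarrow> (('q \<Rightarrow> 'k) \<Rightarrow> 'k)" where
  "lie_poisson = (THE P. poisson_bracket dual Sym P \<and> (\<forall>x y. P (ev x) (ev y) = ev (br x y)))"

definition poisson_commutative :: "(('q \<Rightarrow> 'k) \<Rightarrow> 'k) set \<Rightarrow> bool" where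
  "poisson_commutative A \<longleftrightarrow> (\<forall>F\<in>A. \<forall>G\<in>A. lie_poisson F G = (\<lambda>\<xi>\<in>dual. 0))"

definition Sym_invariants :: "(('q \<Rightarrow> 'k) \<Rightarrow> 'k) set" where
  "Sym_invariants = {H \<in> Sym. \<forall>x. lie_poisson H (ev x) = (\<lambda>\<xi>\<in>dual. 0)}"

text \<open>
  \<open>bihom f m i j\<close> is the image of \<open>S\<^sup>i(f) \<otimes> S\<^sup>j(m)\<close> in the symmetric algebra: the linear span of
  the products of \<open>i\<close> elements of \<open>f\<close> and \<open>j\<close> elements of \<open>m\<close>.
\<close>

inductive_set bihom :: "'q set \<Rightarrow> 'q set \<Rightarrow> nat \<Rightarrow> nat \<Rightarrow> (('q \<Rightarrow> 'k) \<Rightarrow> 'k) set"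
  for f m :: "'q set" and i j :: nat where
  zero: "(\<lambda>\<xi>\<in>dual. 0) \<in> bihom f m i j"
| add_monomial:
    "F \<in> bihom f m i j \<Longrightarrow> length xs = i \<Longrightarrow> set xs \<subseteq> f \<Longrightarrow> length ys = j \<Longrightarrow> set ys \<subseteq> m \<Longrightarrow>
     (\<lambda>\<xi>\<in>dual. F \<xi> + c * (\<Prod>x\<leftarrow>xs. \<xi> x) * (\<Prod>y\<leftarrow>ys. \<xi> y)) \<in> bihom f m i j"

text \<open>
  \<open>h\<close> is the family of bi-homogeneous components of \<open>H\<close>; when the Lie algebra is the direct sum of
  \<open>f\<close> and \<open>m\<close>, each \<open>H\<close> in the symmetric algebra has exactly one such family.
\<close>

definition bihom_components ::
  "'q set \<Rightarrow> 'q set \<Rightarrow> (('q \<Rightarrow> 'k) \<Rightarrow> 'k) \<Rightarrow> (nat \<Rightarrow> nat \<Rightarrow> ('q \<Rightarrow> 'k) \<Rightarrow> 'k) \<Rightarrow> bool" where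
  "bihom_components f m H h \<longleftrightarrow>
     (\<forall>i j. h i j \<in> bihom f m i j) \<and>
     finite {(i, j). h i j \<noteq> (\<lambda>\<xi>\<in>dual. 0)} \<and>
     H = (\<lambda>\<xi>\<in>dual. \<Sum>(i, j) | h i j \<noteq> (\<lambda>\<xi>\<in>dual. 0). h i j \<xi>)"

definition Z_alg :: "'q set \<Rightarrow> 'q set \<Rightarrow> (('q \<Rightarrow> 'k) \<Rightarrow> 'k) set" where
  "Z_alg f m = fun_alg dual {h i j | H h i j. H \<in> Sym_invariants \<and> bihom_components f m H h}"

text \<open>
  The Lie--Poisson bracket exists and is unique: it is
  \<open>{F, G}(\<xi>) = \<xi>([d\<^sub>\<xi>F, d\<^sub>\<xi>G])\<close>, where the differential \<open>d\<^sub>\<xi>F\<close> is regarded as an element of the Lie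
  algebra.
\<close>

context
  notes restrict_apply [simp del] restrict_apply' [simp]
begin

definition has_diff :: "(('q \<Rightarrow> 'k) \<Rightarrow> 'k) \<Rightarrow> ('q \<Rightarrow> 'k) \<Rightarrow> 'q \<Rightarrow> bool" where
  "has_diff F \<xi> x \<longleftrightarrow>
     (\<forall>\<eta>\<in>dual. \<exists>p. (\<forall>t. poly p t = F (\<lambda>z. \<xi> z + t * \<eta> z)) \<and> coeff p 1 = \<eta> x)"

definition differential :: "(('q \<Rightarrow> 'k) \<Rightarrow> 'k) \<Rightarrow> ('q \<Rightarrow> 'k) \<Rightarrow> 'q" where
  "differential F \<xi> = (THE x. has_diff F \<xi> x)"

definition poisson_expl :: "(('q \<Rightarrow> 'k) \<Rightarrow> 'k) \<Rightarrow> (('q \<Rightarrow> 'k) \<Rightarrow> 'k) \<Rightarrow> (('q \<Rightarrow> 'k) \<Rightarrow> 'k)" where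
  "poisson_expl F G =
     (if F \<in> Sym \<and> G \<in> Sym then (\<lambda>\<xi>\<in>dual. \<xi> (br (differential F \<xi>) (differential G \<xi>))) else undefined)"

lemma dual_iff:
  "\<xi> \<in> dual \<longleftrightarrow> (\<forall>x y. \<xi> (x + y) = \<xi> x + \<xi> y) \<and> (\<forall>c x. \<xi> (c *s x) = c * \<xi> x)"
proof -
  have v: "vector_space ((*) :: 'k \<Rightarrow> 'k \<Rightarrow> 'k)"
    by unfold_locales (auto simp: algebra_simps)
  show ?thesis
    unfolding dual_def mem_Collect_eq Vector_Spaces.linear_iff
    using v vector_space_axioms by blast
qed

lemma dual_add: "\<xi> \<in> dual \<Longrightarrow> \<xi> (x + y) = \<xi> x + \<xi> y"
  and dual_scale: "\<xi> \<in> dual \<Longrightarrow> \<xi> (c *s x) = c * \<xi> x"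
  by (auto simp: dual_iff)

lemma dual_zero: "\<xi> \<in> dual \<Longrightarrow> \<xi> 0 = 0"
  using dual_add[of \<xi> 0 0] by simp

lemma dual_minus: "\<xi> \<in> dual \<Longrightarrow> \<xi> (- x) = - \<xi> x"
  using dual_add[of \<xi> x "- x"] dual_zero[of \<xi>] by (simp add: add_eq_0_iff2 add.commute)

lemma dual_line: "\<xi> \<in> dual \<Longrightarrow> \<eta> \<in> dual \<Longrightarrow> (\<lambda>z. \<xi> z + t * \<eta> z) \<in> dual"
  by (auto simp: dual_iff algebra_simps)

lemma dual_separates:
  assumes "\<And>\<eta>. \<eta> \<in> dual \<Longrightarrow> \<eta> x = \<eta> y" shows "x = y"
proof (rule ccontr)
  assume "x \<noteq> y"
  interpret vp: vector_space_pair scale "(*) :: 'k \<Rightarrow> 'k \<Rightarrow> 'k"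
    by unfold_locales (auto simp: algebra_simps)
  have "independent {x - y}"
    using \<open>x \<noteq> y\<close> by (simp add: dependent_single)
  then obtain g where g: "Vector_Spaces.linear scale (*) g" "g (x - y) = (1::'k)"
    using vp.linear_independent_extend[of "{x - y}" "\<lambda>_. 1"] by auto
  then have "g \<in> dual" by (simp add: dual_def)
  then have "g (x - y) = 0"
    using assms[of g] dual_add[of g x "- y"] dual_minus[of g y] by simp
  with g show False by simp
qed

lemma has_diff_unique:
  assumes "has_diff F \<xi> x" "has_diff F \<xi> y" shows "x = y"
proof (rule dual_separates)
  fix \<eta> assume "\<eta> \<in> dual"
  with assms obtain p q where p: "\<forall>t. poly p t = F (\<lambda>z. \<xi> z + t * \<eta> z)" "coeff p 1 = \<eta> x"
    and q: "\<forall>t. poly q t = F (\<lambda>z. \<xi> z + t * \<eta> z)" "coeff q 1 = \<eta> y"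
    unfolding has_diff_def by blast
  then have "poly p = poly q" by auto
  then have "p = q" by (simp add: poly_eq_poly_eq_iff)
  with p q show "\<eta> x = \<eta> y" by simp
qed

lemma diff_eq: "has_diff F \<xi> x \<Longrightarrow> differential F \<xi> = x"
  unfolding differential_def by (blast intro: the_equality has_diff_unique)

lemma has_diff_const: "\<xi> \<in> dual \<Longrightarrow> has_diff (\<lambda>v\<in>dual. c) \<xi> 0"
  unfolding has_diff_def by (auto simp: dual_line dual_zero intro!: exI[of _ "[:c:]"])

lemma has_diff_ev: "\<xi> \<in> dual \<Longrightarrow> has_diff (ev x) \<xi> x"
  unfolding has_diff_def ev_def by (auto simp: dual_line intro!: exI[of _ "[:\<xi> x, _ x:]"])

lemma has_diff_add:
  assumes "\<xi> \<in> dual" "has_diff F \<xi> x" "has_diff G \<xi> y"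
  shows "has_diff (\<lambda>v\<in>dual. F v + G v) \<xi> (x + y)"
  unfolding has_diff_def
proof
  fix \<eta> assume e: "\<eta> \<in> dual"
  with assms obtain p q where "\<forall>t. poly p t = F (\<lambda>z. \<xi> z + t * \<eta> z)" "coeff p 1 = \<eta> x"
    "\<forall>t. poly q t = G (\<lambda>z. \<xi> z + t * \<eta> z)" "coeff q 1 = \<eta> y"
    unfolding has_diff_def by blast
  then show "\<exists>p. (\<forall>t. poly p t = (\<lambda>v\<in>dual. F v + G v) (\<lambda>z. \<xi> z + t * \<eta> z)) \<and> coeff p 1 = \<eta> (x + y)"
    using e assms(1) by (intro exI[of _ "p + q"]) (auto simp: dual_line dual_add)
qed

lemma has_diff_mult:
  assumes "\<xi> \<in> dual" "has_diff F \<xi> x" "has_diff G \<xi> y"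
  shows "has_diff (\<lambda>v\<in>dual. F v * G v) \<xi> (F \<xi> *s y + G \<xi> *s x)"
  unfolding has_diff_def
proof
  fix \<eta> assume e: "\<eta> \<in> dual"
  with assms obtain p q where p: "\<forall>t. poly p t = F (\<lambda>z. \<xi> z + t * \<eta> z)" "coeff p 1 = \<eta> x"
    and q: "\<forall>t. poly q t = G (\<lambda>z. \<xi> z + t * \<eta> z)" "coeff q 1 = \<eta> y"
    unfolding has_diff_def by blast
  have "coeff p 0 = F \<xi>" "coeff q 0 = G \<xi>"
    using spec[OF p(1), of 0] spec[OF q(1), of 0] by (simp_all add: poly_0_coeff_0)
  then have "coeff (p * q) 1 = \<eta> (F \<xi> *s y + G \<xi> *s x)"
    using p q e by (simp add: coeff_mult dual_add dual_scale)
  then show "\<exists>p. (\<forall>t. poly p t = (\<lambda>v\<in>dual. F v * G v) (\<lambda>z. \<xi> z + t * \<eta> z)) \<and>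
      coeff p 1 = \<eta> (F \<xi> *s y + G \<xi> *s x)"
    using e assms(1) p q by (intro exI[of _ "p * q"]) (auto simp: dual_line)
qed

lemma ev_restrict: "restrict (ev x) dual = ev x"
  by (simp add: ev_def)

lemma Sym_ev: "ev x \<in> Sym"
  unfolding Sym_def using fun_alg.gen[of "ev x" "range ev" dual] by (simp add: ev_restrict)

lemma Sym_const: "(\<lambda>v\<in>dual. c) \<in> Sym"
  and Sym_add: "F \<in> Sym \<Longrightarrow> G \<in> Sym \<Longrightarrow> (\<lambda>v\<in>dual. F v + G v) \<in> Sym"
  and Sym_mult: "F \<in> Sym \<Longrightarrow> G \<in> Sym \<Longrightarrow> (\<lambda>v\<in>dual. F v * G v) \<in> Sym"
  unfolding Sym_def by (auto intro: fun_alg.intros)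

lemma Sym_scale:
  assumes "F \<in> Sym" shows "(\<lambda>v\<in>dual. c * F v) \<in> Sym"
proof -
  have "(\<lambda>v\<in>dual. (\<lambda>v\<in>dual. c) v * F v) \<in> Sym" using assms by (intro Sym_mult Sym_const)
  then show ?thesis by (simp cong: restrict_cong)
qed

lemma Sym_induct [consumes 1, case_names const ev add mult]:
  assumes "F \<in> Sym"
    and "\<And>c. Q (\<lambda>v\<in>dual. c)" and "\<And>x. Q (ev x)"
    and "\<And>F G. F \<in> Sym \<Longrightarrow> Q F \<Longrightarrow> G \<in> Sym \<Longrightarrow> Q G \<Longrightarrow> Q (\<lambda>v\<in>dual. F v + G v)"
    and "\<And>F G. F \<in> Sym \<Longrightarrow> Q F \<Longrightarrow> G \<in> Sym \<Longrightarrow> Q G \<Longrightarrow> Q (\<lambda>v\<in>dual. F v * G v)"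
  shows "Q F"
  using assms(1) unfolding Sym_def
proof (induction rule: fun_alg.induct)
  case (gen F) then show ?case using assms(3) by (auto simp: ev_restrict)
qed (use assms in \<open>auto simp: Sym_def\<close>)

lemma Sym_has_diff: "F \<in> Sym \<Longrightarrow> \<xi> \<in> dual \<Longrightarrow> has_diff F \<xi> (differential F \<xi>)"
proof (induction rule: Sym_induct)
  case (const c) then show ?case using has_diff_const diff_eq by metis
next
  case (ev x) then show ?case using has_diff_ev diff_eq by metis
next
  case (add F G) then show ?case using has_diff_add diff_eq by metis
next
  case (mult F G) then show ?case using has_diff_mult diff_eq by metis
qed

lemma diff_simps:
  assumes "\<xi> \<in> dual"
  shows "differential (\<lambda>v\<in>dual. c) \<xi> = 0" and "differential (ev x) \<xi> = x"
    and "F \<in> Sym \<Longrightarrow> G \<in> Sym \<Longrightarrow> differential (\<lambda>v\<in>dual. F v + G v) \<xi> = differential F \<xi> + differential G \<xi>"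
    and "F \<in> Sym \<Longrightarrow> G \<in> Sym \<Longrightarrow>
           differential (\<lambda>v\<in>dual. F v * G v) \<xi> = F \<xi> *s differential G \<xi> + G \<xi> *s differential F \<xi>"
  using assms by (auto intro!: diff_eq has_diff_const has_diff_ev has_diff_add has_diff_mult Sym_has_diff)

lemma diff_scale:
  assumes "\<xi> \<in> dual" "F \<in> Sym" shows "differential (\<lambda>v\<in>dual. c * F v) \<xi> = c *s differential F \<xi>"
proof -
  have "(\<lambda>v\<in>dual. c * F v) = (\<lambda>v\<in>dual. (\<lambda>v\<in>dual. c) v * F v)" by (simp cong: restrict_cong)
  then show ?thesis using assms by (simp add: diff_simps Sym_const)
qed

lemma br_minus_swap: "br y x = - br x y"
proof -
  have "br y x + br x y = 0"
    using br_self[of "x + y"] unfolding br_add_left br_add_right by (simp add: br_self add.commute)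
  then show ?thesis by (simp add: eq_neg_iff_add_eq_0)
qed

lemma br_zero: "br 0 x = 0" "br x 0 = 0"
  using br_scale_left[of 0 x x] br_scale_right[of x 0 x] by simp_all

lemma expl_skew: "F \<in> Sym \<Longrightarrow> G \<in> Sym \<Longrightarrow> poisson_expl G F = (\<lambda>v\<in>dual. - poisson_expl F G v)"
  unfolding poisson_expl_def
  by (auto simp: fun_eq_iff restrict_def dual_minus br_minus_swap[of "differential F _" "differential G _"])

lemma expl_add: "F \<in> Sym \<Longrightarrow> G \<in> Sym \<Longrightarrow> H \<in> Sym \<Longrightarrow>
  poisson_expl (\<lambda>v\<in>dual. F v + G v) H = (\<lambda>v\<in>dual. poisson_expl F H v + poisson_expl G H v)"
  unfolding poisson_expl_def
  by (auto simp: fun_eq_iff restrict_def diff_simps[unfolded restrict_def] Sym_add[unfolded restrict_def] br_add_left dual_add)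

lemma expl_scale: "F \<in> Sym \<Longrightarrow> H \<in> Sym \<Longrightarrow>
  poisson_expl (\<lambda>v\<in>dual. c * F v) H = (\<lambda>v\<in>dual. c * poisson_expl F H v)"
  unfolding poisson_expl_def
  by (auto simp: fun_eq_iff restrict_def diff_scale[unfolded restrict_def] Sym_scale[unfolded restrict_def] br_scale_left dual_scale)

lemma expl_mult: "F \<in> Sym \<Longrightarrow> G \<in> Sym \<Longrightarrow> H \<in> Sym \<Longrightarrow>
  poisson_expl (\<lambda>v\<in>dual. F v * G v) H = (\<lambda>v\<in>dual. F v * poisson_expl G H v + G v * poisson_expl F H v)"
  unfolding poisson_expl_def
  by (auto simp: fun_eq_iff restrict_def diff_simps[unfolded restrict_def] Sym_mult[unfolded restrict_def]
      br_add_left br_scale_left dual_add dual_scale)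

lemma expl_const: "H \<in> Sym \<Longrightarrow> poisson_expl (\<lambda>v\<in>dual. c) H = (\<lambda>v\<in>dual. 0)"
  unfolding poisson_expl_def
  by (auto simp: fun_eq_iff restrict_def diff_simps[unfolded restrict_def] Sym_const[unfolded restrict_def] br_zero dual_zero)

lemma expl_ev: "poisson_expl (ev x) (ev y) = ev (br x y)"
  unfolding poisson_expl_def by (auto simp: Sym_ev diff_simps ev_def[of "br x y"] cong: restrict_cong)

lemma expl_Sym_ev: "F \<in> Sym \<Longrightarrow> poisson_expl F (ev y) \<in> Sym"
proof (induction rule: Sym_induct)
  case (const c) then show ?case by (simp add: expl_const Sym_ev Sym_const)
next
  case (ev x) then show ?case by (simp add: expl_ev Sym_ev)
next
  case (add F G) then show ?case by (simp add: expl_add Sym_ev Sym_add)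
next
  case (mult F G)
  then have "(\<lambda>v\<in>dual. (\<lambda>v\<in>dual. F v * poisson_expl G (ev y) v) v + (\<lambda>v\<in>dual. G v * poisson_expl F (ev y) v) v) \<in> Sym"
    by (intro Sym_add Sym_mult)
  with mult show ?case by (simp add: expl_mult Sym_ev cong: restrict_cong)
qed

lemma expl_Sym: "F \<in> Sym \<Longrightarrow> G \<in> Sym \<Longrightarrow> poisson_expl F G \<in> Sym"
proof (induction F rule: Sym_induct)
  case (const c) then show ?case by (simp add: expl_const Sym_const)
next
  case (ev x)
  then have "(\<lambda>v\<in>dual. (- 1) * poisson_expl G (ev x) v) \<in> Sym"
    by (intro Sym_scale expl_Sym_ev)
  with ev show ?case by (simp add: expl_skew[of G "ev x"] Sym_ev)
next
  case (add F F') then show ?case by (simp add: expl_add Sym_add)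
next
  case (mult F F')
  then have "(\<lambda>v\<in>dual. (\<lambda>v\<in>dual. F v * poisson_expl F' G v) v + (\<lambda>v\<in>dual. F' v * poisson_expl F G v) v) \<in> Sym"
    by (intro Sym_add Sym_mult) auto
  with mult show ?case by (simp add: expl_mult cong: restrict_cong)
qed

text \<open>Pointwise forms of the rules, in either argument.\<close>

lemma expl_at:
  assumes "v \<in> dual" "F \<in> Sym" "G \<in> Sym" "H \<in> Sym"
  shows "poisson_expl (\<lambda>v\<in>dual. F v + G v) H v = poisson_expl F H v + poisson_expl G H v"
    and "poisson_expl (\<lambda>v\<in>dual. F v * G v) H v = F v * poisson_expl G H v + G v * poisson_expl F H v"
    and "poisson_expl H (\<lambda>v\<in>dual. F v + G v) v = poisson_expl H F v + poisson_expl H G v"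
    and "poisson_expl H (\<lambda>v\<in>dual. F v * G v) v = F v * poisson_expl H G v + G v * poisson_expl H F v"
  using assms expl_skew[of F H] expl_skew[of G H]
    expl_skew[of "\<lambda>v\<in>dual. F v + G v" H] expl_skew[of "\<lambda>v\<in>dual. F v * G v" H]
  by (simp_all add: expl_add expl_mult Sym_add Sym_mult algebra_simps)

lemma expl_const_at:
  assumes "v \<in> dual" "H \<in> Sym"
  shows "poisson_expl (\<lambda>v\<in>dual. c) H v = 0" and "poisson_expl H (\<lambda>v\<in>dual. c) v = 0"
  using assms expl_skew[of "\<lambda>v\<in>dual. c" H] by (simp_all add: expl_const Sym_const)

lemma expl_skew_at: "v \<in> dual \<Longrightarrow> F \<in> Sym \<Longrightarrow> G \<in> Sym \<Longrightarrow> poisson_expl F G v = - poisson_expl G F v"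
  by (simp add: expl_skew[of F G])

definition jacobiator :: "(('q \<Rightarrow> 'k) \<Rightarrow> 'k) \<Rightarrow> (('q \<Rightarrow> 'k) \<Rightarrow> 'k) \<Rightarrow> (('q \<Rightarrow> 'k) \<Rightarrow> 'k) \<Rightarrow> ('q \<Rightarrow> 'k) \<Rightarrow> 'k" where
  "jacobiator F G H v =
     poisson_expl F (poisson_expl G H) v + poisson_expl G (poisson_expl H F) v + poisson_expl H (poisson_expl F G) v"

lemma jacobiator_cycle: "jacobiator F G H v = jacobiator G H F v"
  unfolding jacobiator_def by (simp add: algebra_simps)

lemma jacobiator_step:
  assumes "G \<in> Sym" "H \<in> Sym" "\<And>x v. v \<in> dual \<Longrightarrow> jacobiator (ev x) G H v = 0"
  shows "F \<in> Sym \<Longrightarrow> v \<in> dual \<Longrightarrow> jacobiator F G H v = 0"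
proof (induction F arbitrary: v rule: Sym_induct)
  case (const c)
  have "poisson_expl G (\<lambda>v\<in>dual. c) = (\<lambda>v\<in>dual. 0)" "poisson_expl H (\<lambda>v\<in>dual. c) = (\<lambda>v\<in>dual. 0)"
    using assms expl_skew[of "\<lambda>v\<in>dual. c" G] expl_skew[of "\<lambda>v\<in>dual. c" H]
    by (simp_all add: expl_const Sym_const cong: restrict_cong)
  with const assms show ?case
    unfolding jacobiator_def by (simp add: expl_const expl_const_at expl_Sym)
next
  case (ev x) then show ?case using assms by blast
next
  case (add F F')
  have s: "poisson_expl H (\<lambda>v\<in>dual. F v + F' v) = (\<lambda>v\<in>dual. poisson_expl H F v + poisson_expl H F' v)"
    using add.hyps assms expl_skew[of "\<lambda>v\<in>dual. F v + F' v" H] expl_skew[of F H] expl_skew[of F' H]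
    by (simp add: expl_add Sym_add cong: restrict_cong)
  have "jacobiator (\<lambda>v\<in>dual. F v + F' v) G H v = jacobiator F G H v + jacobiator F' G H v"
    using add.hyps add.prems assms
    unfolding jacobiator_def s expl_add[OF add.hyps assms(1)]
    by (simp add: expl_at expl_Sym)
  with add show ?case by simp
next
  case (mult F F')
  have s: "poisson_expl H (\<lambda>v\<in>dual. F v * F' v) =
      (\<lambda>v\<in>dual. (\<lambda>v\<in>dual. F v * poisson_expl H F' v) v + (\<lambda>v\<in>dual. F' v * poisson_expl H F v) v)"
    using mult.hyps assms expl_skew[of "\<lambda>v\<in>dual. F v * F' v" H] expl_skew[of F H] expl_skew[of F' H]
    by (simp add: expl_mult Sym_mult algebra_simps cong: restrict_cong)
  have s': "poisson_expl (\<lambda>v\<in>dual. F v * F' v) G =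
      (\<lambda>v\<in>dual. (\<lambda>v\<in>dual. F v * poisson_expl F' G v) v + (\<lambda>v\<in>dual. F' v * poisson_expl F G v) v)"
    using mult.hyps assms by (simp add: expl_mult cong: restrict_cong)
  have k: "poisson_expl G F v = - poisson_expl F G v" "poisson_expl G F' v = - poisson_expl F' G v"
     "poisson_expl H F v = - poisson_expl F H v" "poisson_expl H F' v = - poisson_expl F' H v"
    using mult.hyps mult.prems assms by (auto intro!: expl_skew_at)
  have "jacobiator (\<lambda>v\<in>dual. F v * F' v) G H v = F v * jacobiator F' G H v + F' v * jacobiator F G H v"
    using mult.hyps mult.prems assms(1,2)
    unfolding jacobiator_def s s'
    by (simp add: expl_at expl_Sym Sym_mult) (simp add: k algebra_simps)
  with mult show ?case by simp
qed

lemma expl_jacobi: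
  assumes "F \<in> Sym" "G \<in> Sym" "H \<in> Sym" "v \<in> dual"
  shows "jacobiator F G H v = 0"
proof -
  have 1: "jacobiator (ev x) (ev y) (ev z) v = 0" if "v \<in> dual" for x y z v
    using that jacobi[of x y z] dual_zero[of v]
    by (simp add: jacobiator_def expl_ev) (simp add: ev_def flip: dual_add)
  have 2: "jacobiator F (ev y) (ev z) v = 0" if "v \<in> dual" "F \<in> Sym" for F y z v
    using jacobiator_step[of "ev y" "ev z" F v] 1 that Sym_ev by blast
  have 3: "jacobiator F G (ev z) v = 0" if "v \<in> dual" "F \<in> Sym" "G \<in> Sym" for F G z v
    using jacobiator_step[of "ev z" F G v] 2 that Sym_ev jacobiator_cycle by metis
  show ?thesis
    using jacobiator_step[of F G H v] 3 assms jacobiator_cycle by metis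
qed

lemma poisson_bracket_expl: "poisson_bracket dual Sym poisson_expl"
  unfolding poisson_bracket_def
proof (intro conjI ballI allI impI)
  fix F G :: "('q \<Rightarrow> 'k) \<Rightarrow> 'k" assume "F \<notin> Sym \<or> G \<notin> Sym"
  then show "poisson_expl F G = undefined" by (auto simp: poisson_expl_def)
next
  fix F G H v assume "F \<in> Sym" "G \<in> Sym" "H \<in> Sym" "v \<in> dual"
  then show "poisson_expl F (poisson_expl G H) v + poisson_expl G (poisson_expl H F) v +
      poisson_expl H (poisson_expl F G) v = 0"
    using expl_jacobi unfolding jacobiator_def by blast
qed (rule expl_Sym expl_skew expl_add expl_scale expl_mult; assumption)+

lemma poisson_bracket_unique:
  assumes P: "poisson_bracket dual Sym P" "\<And>x y. P (ev x) (ev y) = ev (br x y)"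
    and Q: "poisson_bracket dual Sym Q" "\<And>x y. Q (ev x) (ev y) = ev (br x y)"
  shows "P = Q"
proof -
  have on_const: "R (\<lambda>v\<in>dual. c) G = (\<lambda>v\<in>dual. 0)"
    if R: "poisson_bracket dual Sym R" and G: "G \<in> Sym" for R c G
  proof -
    let ?I = "(\<lambda>v\<in>dual. 1) :: ('q \<Rightarrow> 'k) \<Rightarrow> 'k"
    have "R (\<lambda>v\<in>dual. ?I v * ?I v) G = (\<lambda>v\<in>dual. ?I v * R ?I G v + ?I v * R ?I G v)"
      using R G Sym_const unfolding poisson_bracket_def by blast
    moreover have "(\<lambda>v\<in>dual. ?I v * ?I v) = ?I" by (simp cong: restrict_cong)
    ultimately have I: "R ?I G = (\<lambda>v\<in>dual. ?I v * R ?I G v + ?I v * R ?I G v)" by simp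
    have z: "R ?I G v = 0" if "v \<in> dual" for v
    proof -
      have "R ?I G v = R ?I G v + R ?I G v"
        by (subst I) (simp add: that)
      then show ?thesis by simp
    qed
    have "R (\<lambda>v\<in>dual. c * ?I v) G = (\<lambda>v\<in>dual. c * R ?I G v)"
      using R G Sym_const unfolding poisson_bracket_def by blast
    then show ?thesis by (simp add: z cong: restrict_cong)
  qed
  have ind: "P F G = Q F G" if F: "F \<in> Sym" and G: "G \<in> Sym" and e: "\<And>x. P (ev x) G = Q (ev x) G" for F G
    using F
  proof (induction rule: Sym_induct)
    case (const c) then show ?case using on_const[OF P(1) G] on_const[OF Q(1) G] by simp
  next
    case (ev x) then show ?case by (rule e)
  next
    case (add F F')
    then show ?case
      using poisson_bracketD(2)[OF P(1) add.hyps G] poisson_bracketD(2)[OF Q(1) add.hyps G] by simp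
  next
    case (mult F F')
    then show ?case
      using poisson_bracketD(4)[OF P(1) mult.hyps G] poisson_bracketD(4)[OF Q(1) mult.hyps G] by simp
  qed
  have "P (ev x) G = Q (ev x) G" if "G \<in> Sym" for x G
  proof -
    have "P G (ev x) = Q G (ev x)" using ind[OF that Sym_ev] P Q by simp
    then show ?thesis
      using poisson_bracketD(1)[OF P(1) that Sym_ev] poisson_bracketD(1)[OF Q(1) that Sym_ev] by simp
  qed
  then have "P F G = Q F G" if "F \<in> Sym" "G \<in> Sym" for F G using ind that by blast
  moreover have "P F G = Q F G" if "F \<notin> Sym \<or> G \<notin> Sym" for F G
    using P(1) Q(1) that unfolding poisson_bracket_def by metis
  ultimately show ?thesis by (intro ext) metis
qed

lemma lie_poisson_eq_expl: "lie_poisson = poisson_expl"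
  unfolding lie_poisson_def
  using poisson_bracket_expl expl_ev poisson_bracket_unique by (blast intro!: the_equality)

lemma lie_poisson_bracket:
  "poisson_bracket dual Sym lie_poisson" and "lie_poisson (ev x) (ev y) = ev (br x y)"
  unfolding lie_poisson_eq_expl by (rule poisson_bracket_expl expl_ev)+

end

end

end

theory Submission
  imports Defs
begin

text \<open>
  For scalars \<open>s\<close>, \<open>t\<close> let \<open>D s t\<close> act on \<open>q\<close> as \<open>s\<close> on \<open>f\<close> and as \<open>t\<close> on \<open>m\<close>. If \<open>H\<close> has
  components \<open>h i j\<close> and \<open>A\<close> is the differential of \<open>H\<close> at \<open>\<xi> \<circ> D s t\<close>, then \<open>D s t A\<close> is the sum of
  the \<open>s ^ i * t ^ j\<close> multiples of the differentials of \<open>h i j\<close> at \<open>\<xi>\<close>. Let \<open>B\<close> be the differential of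
  a second invariant at \<open>\<xi> \<circ> D s' t'\<close>, and let \<open>u\<close>, \<open>v\<close> be the \<open>m\<close>-parts of \<open>A\<close> and \<open>B\<close>. Invariance,
  tested against \<open>f\<close> (which is abelian), says that \<open>\<xi>\<close> kills \<open>[u, f]\<close> and \<open>[v, f]\<close>; tested against
  \<open>v\<close> and \<open>u\<close>, it then says that \<open>\<xi> \<circ> D s t\<close> and \<open>\<xi> \<circ> D s' t'\<close> kill \<open>[u, v]\<close>. When \<open>(s, t)\<close> and
  \<open>(s', t')\<close> are not proportional, \<open>\<xi>\<close> itself kills \<open>[u, v]\<close>, hence also \<open>[D s t A, D s' t' B]\<close>.
  The coefficients of this polynomial in \<open>s, t, s', t'\<close> are the brackets of the components, at \<open>\<xi>\<close>.
\<close>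

section \<open>Reading off coefficients from values away from two lines\<close>

lemma poly_eq_0_if_cofinite_roots:
  fixes P :: "'k::field_char_0 poly"
  assumes "\<And>s. s \<noteq> a \<Longrightarrow> poly P s = 0"
  shows "P = 0"
proof (rule ccontr)
  assume "P \<noteq> 0"
  then have "finite (insert a {s. poly P s = 0})" by (simp add: poly_roots_finite)
  moreover have "insert a {s. poly P s = 0} = UNIV" using assms by auto
  ultimately show False using infinite_UNIV_char_0[where 'a = 'k] by simp
qed

text \<open>For fixed nonzero \<open>t\<close> the sum is a polynomial in \<open>s\<close> with only
  one value of \<open>s\<close> excluded, so each of its coefficients is zero. Such a coefficient is
  a polynomial in \<open>t\<close> vanishing off 0, so it is zero too.\<close>

lemma bivariate_coeffs_eq_0:
  fixes c :: "nat \<times> nat \<Rightarrow> 'k::field_char_0"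
  assumes "finite S" and "a \<noteq> 0"
    and 0: "\<And>s t. t \<noteq> 0 \<Longrightarrow> s * a \<noteq> b * t \<Longrightarrow> (\<Sum>p\<in>S. s ^ fst p * t ^ snd p * c p) = 0"
    and "p \<in> S"
  shows "c p = 0"
proof -
  \<comment> \<open>This is the coefficient of \<open>s ^ fst p\<close>, still a function of
    \<open>t\<close>.\<close>
  have row: "(\<Sum>q | q \<in> S \<and> fst q = fst p. t ^ snd q * c q) = 0" if "t \<noteq> 0" for t
  proof -
    let ?P = "\<Sum>q\<in>S. monom (t ^ snd q * c q) (fst q)"
    have "?P = 0"
    proof (rule poly_eq_0_if_cofinite_roots)
      fix s assume "s \<noteq> b * t / a"
      then have "s * a \<noteq> b * t" using \<open>a \<noteq> 0\<close> by (auto simp: field_simps)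
      then show "poly ?P s = 0"
        using 0[OF that] by (simp add: poly_sum poly_monom mult_ac)
    qed
    then have "coeff ?P (fst p) = 0" by simp
    then show ?thesis
      using \<open>finite S\<close> by (simp add: coeff_sum sum.If_cases Int_def)
  qed
  let ?Q = "\<Sum>q | q \<in> S \<and> fst q = fst p. monom (c q) (snd q)"
  have "?Q = 0"
    by (rule poly_eq_0_if_cofinite_roots[of 0])
      (use row in \<open>simp add: poly_sum poly_monom mult_ac\<close>)
  then have "coeff ?Q (snd p) = 0" by simp
  then have "(\<Sum>q | (q \<in> S \<and> fst q = fst p) \<and> snd q = snd p. c q) = 0"
    using \<open>finite S\<close> by (simp add: coeff_sum sum.If_cases Int_def)
  moreover have "{q. (q \<in> S \<and> fst q = fst p) \<and> snd q = snd p} = {p}"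
    using \<open>p \<in> S\<close> by (auto simp: prod_eq_iff)
  ultimately show ?thesis by simp
qed

section \<open>Poisson commutativity tested on generators\<close>

declare restrict_apply [simp del] restrict_apply' [simp]

context lie_algebra
begin

lemma dual_sum:
  assumes "\<xi> \<in> dual"
  shows "\<xi> (\<Sum>p\<in>S. c p *s x p) = (\<Sum>p\<in>S. c p * \<xi> (x p))"
  by (induction S rule: infinite_finite_induct)
    (use assms in \<open>simp_all add: dual_zero dual_add dual_scale\<close>)

lemma dual_br:
  assumes "\<xi> \<in> dual"
  shows "(\<lambda>x. \<xi> (br x y)) \<in> dual" and "(\<lambda>x. \<xi> (br y x)) \<in> dual"
  using assms
  by (simp_all add: dual_iff br_add_left br_add_right br_scale_left br_scale_right)

text \<open>Membership and differential are proved together because the sum rule for differentials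
  requires both summands to lie in \<open>Sym\<close>.\<close>

lemma Sym_sum:
  assumes "finite S" and "\<And>p. p \<in> S \<Longrightarrow> F p \<in> Sym"
  shows "(\<lambda>v\<in>dual. \<Sum>p\<in>S. F p v) \<in> Sym \<and>
    (\<forall>\<xi>\<in>dual. differential (\<lambda>v\<in>dual. \<Sum>p\<in>S. F p v) \<xi> = (\<Sum>p\<in>S. differential (F p) \<xi>))"
  using assms
proof (induction S rule: finite_induct)
  case empty
  then show ?case by (simp add: Sym_const diff_simps)
next
  case (insert q S)
  let ?G = "\<lambda>v\<in>dual. \<Sum>p\<in>S. F p v"
  have "(\<lambda>v\<in>dual. \<Sum>p\<in>insert q S. F p v) = (\<lambda>v\<in>dual. F q v + ?G v)"
    using insert.hyps by (simp cong: restrict_cong)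
  moreover have "F q \<in> Sym" "?G \<in> Sym" using insert by auto
  ultimately show ?case
    using insert by (auto simp: Sym_add diff_simps)
qed

lemma lie_poisson_eq_0_iff:
  assumes "F \<in> Sym" "G \<in> Sym"
  shows "lie_poisson F G = (\<lambda>\<xi>\<in>dual. 0) \<longleftrightarrow>
    (\<forall>\<xi>\<in>dual. \<xi> (br (differential F \<xi>) (differential G \<xi>)) = 0)"
  using assms by (auto simp: lie_poisson_eq_expl poisson_expl_def fun_eq_iff restrict_def)

lemma fun_alg_subset_Sym:
  assumes "X \<subseteq> Sym"
  shows "fun_alg dual X \<subseteq> Sym"
proof
  fix F assume "F \<in> fun_alg dual X"
  then show "F \<in> Sym"
  proof (induction rule: fun_alg.induct)
    case (gen F)
    then have "F \<in> Sym" using assms by blast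
    then show ?case
      using fun_alg_extensional extensional_restrict unfolding Sym_def by metis
  qed (simp_all add: Sym_const Sym_add Sym_mult)
qed

text \<open>Bracketing with a fixed \<open>G\<close> is a derivation, and the kernel of a derivation
  is a subalgebra.\<close>

lemma lie_poisson_fun_alg_eq_0:
  assumes X: "X \<subseteq> Sym" and G: "G \<in> Sym"
    and 0: "\<And>F. F \<in> X \<Longrightarrow> lie_poisson F G = (\<lambda>\<xi>\<in>dual. 0)"
    and "F \<in> fun_alg dual X"
  shows "lie_poisson F G = (\<lambda>\<xi>\<in>dual. 0)"
  using assms(4)
proof (induction rule: fun_alg.induct)
  case (const c)
  then show ?case using G by (simp add: lie_poisson_eq_expl expl_const)
next
  case (gen F)
  then have "F \<in> extensional dual" using X fun_alg_extensional unfolding Sym_def by blast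
  then show ?case using gen 0 by (simp add: extensional_restrict)
next
  case (add F F')
  then have "F \<in> Sym" "F' \<in> Sym" using fun_alg_subset_Sym[OF X] by blast+
  then show ?case
    using add.IH G by (simp add: lie_poisson_eq_expl expl_add cong: restrict_cong)
next
  case (mult F F')
  then have "F \<in> Sym" "F' \<in> Sym" using fun_alg_subset_Sym[OF X] by blast+
  then show ?case
    using mult.IH G by (simp add: lie_poisson_eq_expl expl_mult cong: restrict_cong)
qed

lemma lie_poisson_eq_0_swap:
  assumes "F \<in> Sym" "G \<in> Sym" "lie_poisson F G = (\<lambda>\<xi>\<in>dual. 0)"
  shows "lie_poisson G F = (\<lambda>\<xi>\<in>dual. 0)"
  using assms by (simp add: lie_poisson_eq_expl expl_skew[of F G] cong: restrict_cong)

text \<open>The kernel argument is applied once in each argument of the bracket, with skew-symmetry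
  in between.\<close>

lemma poisson_commutative_fun_alg:
  assumes X: "X \<subseteq> Sym"
    and comm: "\<And>F G. F \<in> X \<Longrightarrow> G \<in> X \<Longrightarrow> lie_poisson F G = (\<lambda>\<xi>\<in>dual. 0)"
  shows "poisson_commutative (fun_alg dual X)"
  unfolding poisson_commutative_def
proof (intro ballI)
  fix F G assume F: "F \<in> fun_alg dual X" and G: "G \<in> fun_alg dual X"
  then have S: "F \<in> Sym" "G \<in> Sym" using fun_alg_subset_Sym[OF X] by blast+
  have "lie_poisson F K = (\<lambda>\<xi>\<in>dual. 0)" if "K \<in> X" for K
    using lie_poisson_fun_alg_eq_0[OF X _ _ F, of K] that X comm by blast
  then have "lie_poisson G F = (\<lambda>\<xi>\<in>dual. 0)"
    using lie_poisson_fun_alg_eq_0[OF X S(1) _ G] lie_poisson_eq_0_swap[OF S(1)] X by blast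
  then show "lie_poisson F G = (\<lambda>\<xi>\<in>dual. 0)" using lie_poisson_eq_0_swap S by blast
qed

lemma Sym_prod_list: "(\<lambda>\<xi>\<in>dual. \<Prod>x\<leftarrow>xs. \<xi> x) \<in> Sym"
proof (induction xs)
  case Nil
  then show ?case by (simp add: Sym_const)
next
  case (Cons x xs)
  then have "(\<lambda>\<xi>\<in>dual. ev x \<xi> * (\<lambda>\<xi>\<in>dual. \<Prod>x\<leftarrow>xs. \<xi> x) \<xi>) \<in> Sym"
    by (intro Sym_mult Sym_ev)
  then show ?case by (simp add: ev_def cong: restrict_cong)
qed

lemma bihom_Sym: "F \<in> bihom f m i j \<Longrightarrow> F \<in> Sym"
proof (induction rule: bihom.induct)
  case zero
  then show ?case by (rule Sym_const)
next
  case (add_monomial F xs ys c)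
  have "(\<lambda>\<xi>\<in>dual. F \<xi> + (\<lambda>\<xi>\<in>dual. (\<lambda>\<xi>\<in>dual. c * (\<lambda>\<xi>\<in>dual. \<Prod>x\<leftarrow>xs. \<xi> x) \<xi>) \<xi> *
      (\<lambda>\<xi>\<in>dual. \<Prod>y\<leftarrow>ys. \<xi> y) \<xi>) \<xi>) \<in> Sym"
    by (intro Sym_add Sym_mult Sym_scale Sym_prod_list add_monomial.IH)
  then show ?case by (simp cong: restrict_cong)
qed

end

section \<open>The projections and the scalings \<open>D s t\<close>\<close>

locale abelian_decomposition = lie_algebra scale br
  for scale :: "'k::field_char_0 \<Rightarrow> 'q::ab_group_add \<Rightarrow> 'q" (infixr \<open>*s\<close> 75) and br +
  fixes f m :: "'q set"
  assumes f_sub: "subspace f" and m_sub: "subspace m"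
    and f_inter_m: "f \<inter> m = {0}" and f_plus_m: "{x + y | x y. x \<in> f \<and> y \<in> m} = UNIV"
    and br_fm: "x \<in> f \<Longrightarrow> y \<in> m \<Longrightarrow> br x y \<in> m"
    and br_ff: "x \<in> f \<Longrightarrow> y \<in> f \<Longrightarrow> br x y = 0"
begin

text \<open>\<open>pf\<close> and \<open>pm\<close> are the projections belonging to the direct sum
  of \<open>f\<close> and \<open>m\<close>.\<close>

definition pf :: "'q \<Rightarrow> 'q" where "pf x = (THE a. a \<in> f \<and> x - a \<in> m)"
definition pm :: "'q \<Rightarrow> 'q" where "pm x = x - pf x"

lemma pf_eq:
  assumes "a \<in> f" "x - a \<in> m" shows "pf x = a"
  unfolding pf_def
proof (rule the_equality)
  fix b assume "b \<in> f \<and> x - b \<in> m"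
  then have "a - b \<in> f" "a - b \<in> m"
    using assms subspace_diff[OF f_sub, of a b] subspace_diff[OF m_sub, of "x - b" "x - a"] by auto
  then have "a - b = 0" using f_inter_m by blast
  then show "b = a" by simp
qed (use assms in auto)

lemma pf_in: "pf x \<in> f" and pm_in: "pm x \<in> m"
proof -
  have "x \<in> {a + b | a b. a \<in> f \<and> b \<in> m}" by (simp add: f_plus_m)
  then obtain a b where "x = a + b" "a \<in> f" "b \<in> m" by blast
  then have "pf x = a" by (intro pf_eq) auto
  then show "pf x \<in> f" "pm x \<in> m" using \<open>x = a + b\<close> \<open>a \<in> f\<close> \<open>b \<in> m\<close> by (simp_all add: pm_def)
qed

lemma pf_plus_pm: "pf x + pm x = x"
  by (simp add: pm_def)

lemma pf_on_f: "x \<in> f \<Longrightarrow> pf x = x" and pf_on_m: "x \<in> m \<Longrightarrow> pf x = 0"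
  by (auto intro!: pf_eq simp: subspace_0[OF f_sub] subspace_0[OF m_sub])

lemma pf_add: "pf (x + y) = pf x + pf y"
  using subspace_add[OF m_sub pm_in[of x] pm_in[of y]]
  by (intro pf_eq subspace_add[OF f_sub] pf_in) (simp add: pm_def algebra_simps)

lemma pf_scale: "pf (c *s x) = c *s pf x"
  using subspace_scale[OF m_sub pm_in[of x]]
  by (intro pf_eq subspace_scale[OF f_sub] pf_in) (simp add: pm_def scale_right_diff_distrib)

definition D :: "'k \<Rightarrow> 'k \<Rightarrow> 'q \<Rightarrow> 'q" where
  "D s t x = s *s pf x + t *s pm x"

lemma D_add: "D s t (x + y) = D s t x + D s t y"
  by (simp add: D_def pm_def pf_add algebra_simps)

lemma D_scale: "D s t (c *s x) = c *s D s t x"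
  by (simp add: D_def pm_def pf_scale algebra_simps)

lemma D_zero: "D s t 0 = 0"
  using D_scale[of s t 0 0] by simp

lemma D_sum: "D s t (\<Sum>p\<in>S. x p) = (\<Sum>p\<in>S. D s t (x p))"
  by (induction S rule: infinite_finite_induct) (simp_all add: D_zero D_add)

lemma D_on_f: "x \<in> f \<Longrightarrow> D s t x = s *s x" and D_on_m: "x \<in> m \<Longrightarrow> D s t x = t *s x"
  by (simp_all add: D_def pm_def pf_on_f pf_on_m)

section \<open>Bi-homogeneity under the scalings\<close>

lemma dual_D: "\<xi> \<in> dual \<Longrightarrow> (\<lambda>x. \<xi> (D s t x)) \<in> dual"
  by (simp add: dual_iff D_add D_scale)

lemma dual_D_prod_list:
  assumes "\<xi> \<in> dual" and "\<And>x. x \<in> set xs \<Longrightarrow> D s t x = r *s x"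
  shows "(\<Prod>x\<leftarrow>xs. \<xi> (D s t x)) = r ^ length xs * (\<Prod>x\<leftarrow>xs. \<xi> x)"
  using assms(2) by (induction xs) (simp_all add: dual_scale[OF assms(1)])

text \<open>In each monomial the \<open>i\<close> factors from \<open>f\<close> contribute
  \<open>s\<close> each and the \<open>j\<close> factors from \<open>m\<close> contribute
  \<open>t\<close> each.\<close>

lemma bihom_D:
  assumes "F \<in> bihom f m i j" "\<xi> \<in> dual"
  shows "F (\<lambda>x. \<xi> (D s t x)) = s ^ i * t ^ j * F \<xi>"
  using assms(1)
proof (induction rule: bihom.induct)
  case zero
  then show ?case by (simp add: assms(2) dual_D)
next
  case (add_monomial F xs ys c)
  have "(\<Prod>x\<leftarrow>xs. \<xi> (D s t x)) = s ^ i * (\<Prod>x\<leftarrow>xs. \<xi> x)"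
    "(\<Prod>y\<leftarrow>ys. \<xi> (D s t y)) = t ^ j * (\<Prod>y\<leftarrow>ys. \<xi> y)"
    using add_monomial.hyps dual_D_prod_list[OF assms(2), of xs s t s]
      dual_D_prod_list[OF assms(2), of ys s t t] D_on_f D_on_m by blast+
  then show ?case
    by (simp add: assms(2) dual_D add_monomial.IH algebra_simps)
qed

text \<open>This is \<open>bihom_D\<close> differentiated along a direction \<open>\<eta>\<close>.
  By the chain rule, the left side pairs \<open>\<eta> \<circ> D s t\<close> with the differential
  at \<open>\<xi> \<circ> D s t\<close>.\<close>

lemma differential_bihom_D:
  assumes F: "F \<in> bihom f m i j" and \<xi>: "\<xi> \<in> dual"
  shows "D s t (differential F (\<lambda>x. \<xi> (D s t x))) = (s ^ i * t ^ j) *s differential F \<xi>"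
proof (rule dual_separates)
  fix \<eta> assume \<eta>: "\<eta> \<in> dual"
  let ?\<xi> = "\<lambda>x. \<xi> (D s t x)" and ?\<eta> = "\<lambda>x. \<eta> (D s t x)"
  have d: "has_diff F \<xi> (differential F \<xi>)" "has_diff F ?\<xi> (differential F ?\<xi>)"
    by (rule Sym_has_diff[OF bihom_Sym[OF F]], (rule dual_D)?, rule \<xi>)+
  obtain p where p: "\<forall>r. poly p r = F (\<lambda>z. \<xi> z + r * \<eta> z)" "coeff p 1 = \<eta> (differential F \<xi>)"
    using d(1)[unfolded has_diff_def, THEN bspec, OF \<eta>] by blast
  obtain q where q: "\<forall>r. poly q r = F (\<lambda>z. ?\<xi> z + r * ?\<eta> z)" "coeff q 1 = ?\<eta> (differential F ?\<xi>)"
    using d(2)[unfolded has_diff_def, THEN bspec, OF dual_D[OF \<eta>]] by blast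
  \<comment> \<open>Scaling the line through \<open>\<xi>\<close> in direction \<open>\<eta>\<close>
    by \<open>D s t\<close> gives the line defining \<open>q\<close>; the linear coefficients are
    then compared.\<close>
  have "poly q r = poly (smult (s ^ i * t ^ j) p) r" for r
    using bihom_D[OF F dual_line[OF \<xi> \<eta>], of s t r] by (simp add: p q)
  then have "q = smult (s ^ i * t ^ j) p" by (simp add: poly_eq_poly_eq_iff[symmetric] fun_eq_iff)
  then show "\<eta> (D s t (differential F ?\<xi>)) = \<eta> ((s ^ i * t ^ j) *s differential F \<xi>)"
    using p q \<eta> by (simp add: dual_scale)
qed

section \<open>Vanishing of the bracket for non-proportional scalings\<close>

text \<open>\<open>A\<close> and \<open>B\<close> stand for differentials of two invariants, at
  \<open>\<xi> \<circ> D s t\<close> and at \<open>\<xi> \<circ> D s' t'\<close>; the last two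
  assumptions are their invariance.\<close>

lemma br_D_eq_0:
  assumes \<xi>: "\<xi> \<in> dual" and t: "t \<noteq> 0" "t' \<noteq> 0" and st: "s * t' \<noteq> s' * t"
    and A: "\<And>x. \<xi> (D s t (br A x)) = 0" and B: "\<And>x. \<xi> (D s' t' (br B x)) = 0"
  shows "\<xi> (br (D s t A) (D s' t' B)) = 0"
proof -
  have sw: "\<xi> (br x y) = - \<xi> (br y x)" for x y
    using br_minus_swap[of x y] dual_minus[OF \<xi>] by simp
  have D_fm: "\<xi> (D s t (br x y)) = t * \<xi> (br x y)" if "x \<in> f" "y \<in> m" for s t x y
    using that by (simp add: D_on_m br_fm dual_scale[OF \<xi>])
  have D_swap: "\<xi> (D s t (br x y)) = - \<xi> (D s t (br y x))" for s t x y
    using br_minus_swap[of x y] dual_minus[OF dual_D[OF \<xi>, of s t]] by simp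
  have split: "\<xi> (D s t (br C x)) = \<xi> (D s t (br (pf C) x)) + \<xi> (D s t (br (pm C) x))" for s t C x
    using br_add_left[of "pf C" "pm C" x] by (simp add: pf_plus_pm D_add dual_add[OF \<xi>])
  \<comment> \<open>In \<open>br C x\<close> with \<open>x\<close> in \<open>f\<close>, the
    \<open>pf C\<close> term vanishes because \<open>f\<close> is abelian. The other term lies in
    \<open>m\<close>, where \<open>D s t\<close> is multiplication by the nonzero
    \<open>t\<close>.\<close>
  have f0: "\<xi> (br x (pm C)) = 0"
    if "t \<noteq> 0" "\<And>x. \<xi> (D s t (br C x)) = 0" "x \<in> f" for s t C x
  proof -
    have "t * \<xi> (br x (pm C)) = 0"
      using that split[of s t C x] D_swap[of s t "pm C" x] D_fm[OF \<open>x \<in> f\<close> pm_in, of s t C]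
      by (simp add: br_ff pf_in D_zero dual_zero[OF \<xi>])
    then show ?thesis using that by simp
  qed
  note Af = f0[OF t(1) A] and Bf = f0[OF t(2) B]
  \<comment> \<open>\<open>A\<close> is tested against \<open>pm B\<close>; the \<open>pf A\<close>
    term is removed by \<open>Bf\<close>, that is, by the invariance of the other element.\<close>
  have 1: "\<xi> (D s t (br (pm A) (pm B))) = 0"
    using split[of s t A "pm B"] A Bf[OF pf_in] D_fm[OF pf_in pm_in, of s t A B] by simp
  have 2: "\<xi> (D s' t' (br (pm A) (pm B))) = 0"
    using split[of s' t' B "pm A"] B Af[OF pf_in] D_fm[OF pf_in pm_in, of s' t' B A]
      D_swap[of s' t' "pm A" "pm B"] by simp
  \<comment> \<open>The two vanishing statements form a linear system for \<open>a\<close> and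
    \<open>b\<close> with determinant \<open>s * t' - s' * t\<close>.\<close>
  define a b where "a = \<xi> (pf (br (pm A) (pm B)))" and "b = \<xi> (pm (br (pm A) (pm B)))"
  have e: "s * a + t * b = 0" "s' * a + t' * b = 0"
    using 1 2 by (simp_all add: a_def b_def D_def dual_add[OF \<xi>] dual_scale[OF \<xi>])
  have "t' * (s * a + t * b) - t * (s' * a + t' * b) = (s * t' - s' * t) * a"
    by (simp add: algebra_simps)
  then have "a = 0" using e st by simp
  moreover from this have "b = 0" using e t by simp
  ultimately have 3: "\<xi> (br (pm A) (pm B)) = 0"
    using pf_plus_pm[of "br (pm A) (pm B)"] dual_add[OF \<xi>] unfolding a_def b_def by (metis add_0)
  \<comment> \<open>Expanding both \<open>D\<close> terms, the \<open>f\<close>-\<open>f\<close>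
    bracket is zero, the mixed ones vanish under \<open>\<xi>\<close> by \<open>Af\<close> and
    \<open>Bf\<close>, and the \<open>m\<close>-\<open>m\<close> one by \<open>3\<close>.\<close>
  show ?thesis
    using 3 Af[OF pf_in, of B] Bf[OF pf_in, of A] sw[of "pm A" "pf B"]
    by (simp add: D_def br_add_left br_add_right br_scale_left br_scale_right
        dual_add[OF \<xi>] dual_scale[OF \<xi>] br_ff pf_in dual_zero[OF \<xi>])
qed

section \<open>Extracting the brackets of the components\<close>

text \<open>This supplies the inputs of \<open>br_D_eq_0\<close> and
  \<open>bivariate_coeffs_eq_0\<close> at a fixed \<open>\<xi>\<close>: \<open>A s t\<close> is the
  differential of \<open>H\<close> at \<open>\<xi> \<circ> D s t\<close>, and \<open>S\<close>
  indexes the nonzero components.\<close>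

lemma differential_components:
  assumes H: "H \<in> Sym_invariants" "bihom_components f m H h" and \<xi>: "\<xi> \<in> dual"
  obtains S A where "finite S" and "\<forall>i j. (i, j) \<notin> S \<longrightarrow> differential (h i j) \<xi> = 0"
    and "\<forall>s t x. \<xi> (D s t (br (A s t) x)) = 0"
    and "\<forall>s t. D s t (A s t) =
      (\<Sum>p\<in>S. (s ^ fst p * t ^ snd p) *s differential (h (fst p) (snd p)) \<xi>)"
proof -
  define S where "S = {(i, j). h i j \<noteq> (\<lambda>\<xi>\<in>dual. 0)}"
  define A where "A s t = differential H (\<lambda>x. \<xi> (D s t x))" for s t
  have h: "h i j \<in> bihom f m i j" for i j
    using H(2) unfolding bihom_components_def by blast
  have eq: "H = (\<lambda>\<xi>\<in>dual. \<Sum>p\<in>S. h (fst p) (snd p) \<xi>)"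
    using H(2) unfolding bihom_components_def S_def case_prod_beta' by blast
  have HS: "H \<in> Sym" and "\<And>x. lie_poisson H (ev x) = (\<lambda>\<xi>\<in>dual. 0)"
    using H(1) unfolding Sym_invariants_def by auto
  \<comment> \<open>The differential of \<open>ev x\<close> is \<open>x\<close>, so commuting with
    all \<open>ev x\<close> is a pointwise condition on the differential of
    \<open>H\<close>.\<close>
  then have inv: "\<zeta> (br (differential H \<zeta>) x) = 0" if "\<zeta> \<in> dual" for \<zeta> x
    using lie_poisson_eq_0_iff[OF HS Sym_ev] that diff_simps(2)[OF that] by metis
  show thesis
  proof (rule that)
    show fin: "finite S"
      using H(2) unfolding bihom_components_def S_def by blast
    show "\<forall>i j. (i, j) \<notin> S \<longrightarrow> differential (h i j) \<xi> = 0"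
      using \<xi> diff_simps(1) by (simp add: S_def)
    show "\<forall>s t x. \<xi> (D s t (br (A s t) x)) = 0"
      unfolding A_def using inv[OF dual_D[OF \<xi>]] by blast
    have "\<forall>\<zeta>\<in>dual. differential H \<zeta> = (\<Sum>p\<in>S. differential (h (fst p) (snd p)) \<zeta>)"
      using Sym_sum[OF fin, of "\<lambda>p. h (fst p) (snd p)", OF bihom_Sym[OF h], THEN conjunct2]
      unfolding eq[symmetric] .
    then have "A s t = (\<Sum>p\<in>S. differential (h (fst p) (snd p)) (\<lambda>x. \<xi> (D s t x)))" for s t
      unfolding A_def using dual_D[OF \<xi>] by (rule bspec)
    then show "\<forall>s t. D s t (A s t) =
        (\<Sum>p\<in>S. (s ^ fst p * t ^ snd p) *s differential (h (fst p) (snd p)) \<xi>)"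
      by (simp add: D_sum differential_bihom_D[OF h \<xi>])
  qed
qed

text \<open>Coefficients are extracted twice: first in the scaling parameters of \<open>H\<close>,
  with those of \<open>H'\<close> fixed, and then in those of \<open>H'\<close>.\<close>

lemma components_commute:
  assumes H: "H \<in> Sym_invariants" "bihom_components f m H h"
    and H': "H' \<in> Sym_invariants" "bihom_components f m H' h'"
  shows "lie_poisson (h i j) (h' k l) = (\<lambda>\<xi>\<in>dual. 0)"
proof -
  have hS: "h i j \<in> Sym" "h' k l \<in> Sym" for i j k l
    using H(2) H'(2) bihom_Sym unfolding bihom_components_def by blast+
  show ?thesis
    unfolding lie_poisson_eq_0_iff[OF hS]
  proof
    fix \<xi> assume \<xi>: "\<xi> \<in> dual"
    obtain S A where S: "finite S" "\<forall>i j. (i, j) \<notin> S \<longrightarrow> differential (h i j) \<xi> = 0"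
      and A: "\<forall>s t x. \<xi> (D s t (br (A s t) x)) = 0"
        "\<forall>s t. D s t (A s t) =
          (\<Sum>p\<in>S. (s ^ fst p * t ^ snd p) *s differential (h (fst p) (snd p)) \<xi>)"
      by (rule differential_components[OF H \<xi>])
    obtain S' A' where S': "finite S'" "\<forall>i j. (i, j) \<notin> S' \<longrightarrow> differential (h' i j) \<xi> = 0"
      and A': "\<forall>s t x. \<xi> (D s t (br (A' s t) x)) = 0"
        "\<forall>s t. D s t (A' s t) =
          (\<Sum>p\<in>S'. (s ^ fst p * t ^ snd p) *s differential (h' (fst p) (snd p)) \<xi>)"
      by (rule differential_components[OF H' \<xi>])
    have half: "\<xi> (br (differential (h i j) \<xi>) (D s' t' (A' s' t'))) = 0"
      if "t' \<noteq> 0" "(i, j) \<in> S" for s' t' i j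
    proof -
      let ?c = "\<lambda>p. \<xi> (br (differential (h (fst p) (snd p)) \<xi>) (D s' t' (A' s' t')))"
      have "?c (i, j) = 0"
      \<comment> \<open>With \<open>a = t'\<close> and \<open>b = s'\<close> the excluded pairs are
        those with \<open>t = 0\<close> and those proportional to \<open>(s', t')\<close>.\<close>
      proof (rule bivariate_coeffs_eq_0[OF S(1) that(1) _ that(2), where b = s'])
        fix s t assume "t \<noteq> 0" "s * t' \<noteq> s' * t"
        then have "\<xi> (br (D s t (A s t)) (D s' t' (A' s' t'))) = 0"
          using br_D_eq_0[OF \<xi> _ that(1) _ A(1)[rule_format] A'(1)[rule_format]] by blast
        then show "(\<Sum>p\<in>S. s ^ fst p * t ^ snd p * ?c p) = 0"
          unfolding A(2)[rule_format] dual_sum[OF dual_br(1)[OF \<xi>]] .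
      qed
      then show ?thesis by simp
    qed
    show "\<xi> (br (differential (h i j) \<xi>) (differential (h' k l) \<xi>)) = 0"
    proof (cases "(i, j) \<in> S \<and> (k, l) \<in> S'")
      case True
      let ?c = "\<lambda>p. \<xi> (br (differential (h i j) \<xi>) (differential (h' (fst p) (snd p)) \<xi>))"
      have "?c (k, l) = 0"
      \<comment> \<open>The choice \<open>a = 1\<close>, \<open>b = 0\<close> is arbitrary, since
        \<open>half\<close> applies at every \<open>s\<close> once \<open>t\<close> is
        nonzero.\<close>
      proof (rule bivariate_coeffs_eq_0[OF S'(1) one_neq_zero, where b = 0])
        fix s t :: 'k assume "t \<noteq> 0"
        with half True have "\<xi> (br (differential (h i j) \<xi>) (D s t (A' s t))) = 0" by blast
        then show "(\<Sum>p\<in>S'. s ^ fst p * t ^ snd p * ?c p) = 0"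
          unfolding A'(2)[rule_format] dual_sum[OF dual_br(2)[OF \<xi>]] .
      qed (use True in simp)
      then show ?thesis by simp
    next
      case False
      then show ?thesis using S(2) S'(2) \<xi> by (auto simp: br_zero dual_zero)
    qed
  qed
qed

lemma poisson_commutative_Z_alg: "poisson_commutative (Z_alg f m)"
  unfolding Z_alg_def
proof (rule poisson_commutative_fun_alg)
  show "{h i j | H h i j. H \<in> Sym_invariants \<and> bihom_components f m H h} \<subseteq> Sym"
    unfolding bihom_components_def using bihom_Sym by blast
qed (use components_commute in blast)

end

section \<open>The Lie algebra of a connected algebraic group\<close>

theorem corollary2p2:
  fixes scale :: "'k::{alg_closed_field, field_char_0} \<Rightarrow> 'q::ab_group_add \<Rightarrow> 'q"
    and br :: "'q \<Rightarrow> 'q \<Rightarrow> 'q"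
    and n :: nat and G :: "(nat \<Rightarrow> 'k) monoid"
    and f m :: "'q set"
  assumes "lie_algebra scale br"
    and "connected_algebraic_group n G"
    and "lie_algebra.is_Lie_algebra_of scale br n G"
    and "lie_algebra.lie_subalgebra scale br f"
    and "module.subspace scale m"
    and "f \<inter> m = {0}" and "{x + y | x y. x \<in> f \<and> y \<in> m} = UNIV"
    and "\<forall>x\<in>f. \<forall>y\<in>m. br x y \<in> m"
    and "\<forall>x\<in>f. \<forall>y\<in>f. br x y = 0"
  shows "lie_algebra.poisson_commutative scale br (lie_algebra.Z_alg scale br f m)"
proof -
  interpret lie_algebra scale br by fact
  interpret abelian_decomposition scale br f m
    by unfold_locales (use assms in \<open>auto simp: lie_subalgebra_def\<close>)
  show ?thesis by (rule poisson_commutative_Z_alg)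
qed

end
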